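(* Let $m\ge 0$ be an integer and let $\psi,\varphi,\phi$ be entire functions with $\phi\not\equiv 0$, and suppose that $\psi$ is zero free. Let $\mathbb{S}_{\max}$ be the maximal multi-valued weighted composition operator on $\mathcal{F}^2$ induced by the equation $\psi\cdot f\circ\varphi=\phi\cdot g^{(m)}$. The operator $\mathbb{S}_{\max}$ is unitary if and only if $m=0$ and the symbols are of the following form: $$\varphi(z)=Az+B,\qquad \psi(z)=De^{-A\overline{B}z-|B|^2/2},\qquad z\in\mathbb{C},$$ where $A,B,D$ are complex constants with $|A|=1$ and $|D|=1$.
   Context: Fock space $\mathcal{F}^2$ is the Hilbert space of entire functions $f$ with $\int_{\mathbb{C}}|f(z)|^2e^{-|z|^2}dV(z)<\infty$, with inner product $\langle f,g\rangle=\frac1\pi\int_{\mathbb{C}}f(z)\overline{g(z)}e^{-|z|^2}dV(z)$, where $dV$ is area measure. A multi-valued linear operator $\mathbb{A}$ on a Hilbert space $\mathcal{H}$ assigns to each $x$ in a subspace $\mathrm{dom}(\mathbb{A})\subset\mathcal{H}$ a nonempty subset $\mathbb{A}(x)\subset\mathcal{H}$ such that its graph $G(\mathbb{A})=\{(x,y):x\in\mathrm{dom}(\mathbb{A}),\,y\in\mathbb{A}(x)\}$ is a linear subspace of $\mathcal{H}\times\mathcal{H}$; $\mathbb{A}$ is determined by $G(\mathbb{A})$. The operator $\mathbb{S}_{\max}$ is given by $G(\mathbb{S}_{\max})=\{(f,g)\in\mathcal{F}^2\times\mathcal{F}^2:\psi(z)f(\varphi(z))=\phi(z)g^{(m)}(z)\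 \forall z\in\mathbb{C}\}$. The adjoint $\mathbb{A}^*$ is given by $G(\mathbb{A}^* )=\{(u,v):\langle g,u\rangle=\langle f,v\rangle\ \forall (f,g)\in G(\mathbb{A})\}$, and the inverse by $G(\mathbb{A}^{-1})=\{(x,y):(y,x)\in G(\mathbb{A})\}$. $\mathbb{A}$ is unitary if $G(\mathbb{A}^* )=G(\mathbb{A}^{-1})$.
   Formalization: The formula for ψ is corrected to ψ(z)=φ(z)·D·exp(−A·conj(B)·z−|B|²/2), with φ the factor multiplying g^(m); as printed the claim fails, e.g. for m=0, identity composition symbol, ψ=1 and that factor equal to 2, where g=f/2 is not unitary. *)

theory Defs
  imports "HOL-Complex_Analysis.Complex_Analysis"
begin

definition fock_space :: "(complex \<Rightarrow> complex) set" where
  "fock_space = {f. f holomorphic_on UNIV \<and>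
     integrable lborel (\<lambda>z. (norm (f z))\<^sup>2 * exp (- (norm z)\<^sup>2))}"

definition fock_inner :: "(complex \<Rightarrow> complex) \<Rightarrow> (complex \<Rightarrow> complex) \<Rightarrow> complex" where
  "fock_inner f g =
     of_real (1 / pi) * (LINT z|lborel. f z * cnj (g z) * of_real (exp (- (norm z)\<^sup>2)))"

text \<open>
  A multi-valued linear operator is represented by its graph, a linear subspace of
  \<open>fock_space \<times> fock_space\<close>; the domain is then \<open>Domain G\<close>, the value at \<open>x\<close>
  is \<open>G `` {x}\<close> (nonempty for \<open>x\<close> in the domain), and the inverse is \<open>G\<inverse>\<close>.
\<close>

type_synonym fock_relation = "((complex \<Rightarrow> complex) \<times> (complex \<Rightarrow> complex)) set"

definition multivalued_linear :: "fock_relation \<Rightarrow> bool" where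
  "multivalued_linear G \<longleftrightarrow>
     G \<subseteq> fock_space \<times> fock_space \<and> ((\<lambda>z. 0), (\<lambda>z. 0)) \<in> G \<and>
     (\<forall>f g u v. (f, g) \<in> G \<longrightarrow> (u, v) \<in> G \<longrightarrow> ((\<lambda>z. f z + u z), (\<lambda>z. g z + v z)) \<in> G) \<and>
     (\<forall>c f g. (f, g) \<in> G \<longrightarrow> ((\<lambda>z. c * f z), (\<lambda>z. c * g z)) \<in> G)"

definition fock_adjoint :: "fock_relation \<Rightarrow> fock_relation" where
  "fock_adjoint G = {(u, v). u \<in> fock_space \<and> v \<in> fock_space \<and>
     (\<forall>(f, g) \<in> G. fock_inner g u = fock_inner f v)}"

definition fock_unitary :: "fock_relation \<Rightarrow> bool" where
  "fock_unitary G \<longleftrightarrow> fock_adjoint G = G\<inverse>"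

text \<open>
  Multiplying \<open>psi\<close> and \<open>phi\<close> by a common zero-free entire function does not change
  \<open>S_max m psi vphi phi\<close>, so the operator determines these two symbols only through
  the quotient \<open>psi / phi\<close>.
\<close>

definition S_max ::
  "nat \<Rightarrow> (complex \<Rightarrow> complex) \<Rightarrow> (complex \<Rightarrow> complex) \<Rightarrow> (complex \<Rightarrow> complex) \<Rightarrow> fock_relation"
  where "S_max m psi vphi phi = {(f, g). f \<in> fock_space \<and> g \<in> fock_space \<and>
     (\<forall>z. psi z * f (vphi z) = phi z * (deriv ^^ m) g z)}"

lemma zero_in_fock_space: "(\<lambda>z. 0) \<in> fock_space"
  by (simp add: fock_space_def)

lemma scale_in_fock_space:
  assumes "f \<in> fock_space"
  shows "(\<lambda>z. c * f z) \<in> fock_space"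
proof -
  have "integrable lborel (\<lambda>z. (norm c)\<^sup>2 * ((norm (f z))\<^sup>2 * exp (- (norm z)\<^sup>2)))"
    using assms by (intro integrable_mult_right) (auto simp: fock_space_def)
  then show ?thesis
    using assms
    by (auto simp: fock_space_def norm_mult power_mult_distrib mult.assoc intro!: holomorphic_intros)
qed

lemma add_in_fock_space:
  assumes "f \<in> fock_space" "g \<in> fock_space"
  shows "(\<lambda>z. f z + g z) \<in> fock_space"
proof -
  have h: "f holomorphic_on UNIV" "g holomorphic_on UNIV"
    using assms by (auto simp: fock_space_def)
  then have c: "continuous_on UNIV f" "continuous_on UNIV g"
    using holomorphic_on_imp_continuous_on by blast+
  let ?w = "\<lambda>z :: complex. exp (- (norm z)\<^sup>2)"
  have "integrable lborel (\<lambda>z. 2 * ((norm (f z))\<^sup>2 * ?w z) + 2 * ((norm (g z))\<^sup>2 * ?w z))"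
    using assms
    by (intro Bochner_Integration.integrable_add integrable_mult_right) (auto simp: fock_space_def)
  moreover have "(\<lambda>z. (norm (f z + g z))\<^sup>2 * ?w z) \<in> borel_measurable lborel"
    unfolding measurable_lborel2
    by (intro borel_measurable_continuous_onI continuous_intros c)
  moreover have "norm ((norm (f z + g z))\<^sup>2 * ?w z) \<le>
      norm (2 * ((norm (f z))\<^sup>2 * ?w z) + 2 * ((norm (g z))\<^sup>2 * ?w z))" for z
  proof -
    have "(norm (f z + g z))\<^sup>2 \<le> (norm (f z) + norm (g z))\<^sup>2"
      by (intro power_mono norm_triangle_ineq) auto
    also have "\<dots> \<le> 2 * (norm (f z))\<^sup>2 + 2 * (norm (g z))\<^sup>2"
      using sum_squares_bound[of "norm (f z)" "norm (g z)"] by (simp add: power2_sum)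
    finally have "(norm (f z + g z))\<^sup>2 * ?w z \<le> (2 * (norm (f z))\<^sup>2 + 2 * (norm (g z))\<^sup>2) * ?w z"
      by (intro mult_right_mono) auto
    then show ?thesis
      by (simp add: algebra_simps)
  qed
  ultimately have "integrable lborel (\<lambda>z. (norm (f z + g z))\<^sup>2 * ?w z)"
    using Bochner_Integration.integrable_bound[OF _ _ AE_I2] by blast
  then show ?thesis
    using h by (auto simp: fock_space_def intro!: holomorphic_intros)
qed

lemma multivalued_linear_S_max: "multivalued_linear (S_max m psi vphi phi)"
proof -
  have add: "(deriv ^^ m) (\<lambda>z. g z + v z) z = (deriv ^^ m) g z + (deriv ^^ m) v z"
    if "g \<in> fock_space" "v \<in> fock_space" for g v z
    using that by (intro higher_deriv_add[of _ UNIV]) (auto simp: fock_space_def)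
  have scale: "(deriv ^^ m) (\<lambda>z. c * g z) z = c * (deriv ^^ m) g z"
    if "g \<in> fock_space" for c g z
    using that by (intro higher_deriv_cmult[of _ UNIV]) (auto simp: fock_space_def)
  have zero: "(deriv ^^ m) (\<lambda>z. 0) z = 0" for z :: complex
    using scale[OF zero_in_fock_space, of 0 z] by simp
  have "S_max m psi vphi phi \<subseteq> fock_space \<times> fock_space"
    by (auto simp: S_max_def)
  moreover have "((\<lambda>z. 0), (\<lambda>z. 0)) \<in> S_max m psi vphi phi"
    by (simp add: S_max_def zero zero_in_fock_space)
  moreover have "((\<lambda>z. f z + u z), (\<lambda>z. g z + v z)) \<in> S_max m psi vphi phi"
    if "(f, g) \<in> S_max m psi vphi phi" "(u, v) \<in> S_max m psi vphi phi" for f g u v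
    using that by (simp add: S_max_def add add_in_fock_space distrib_left)
  moreover have "((\<lambda>z. c * f z), (\<lambda>z. c * g z)) \<in> S_max m psi vphi phi"
    if "(f, g) \<in> S_max m psi vphi phi" for c f g
    using that by (simp add: S_max_def scale scale_in_fock_space mult.left_commute[of _ c])
  ultimately show ?thesis
    unfolding multivalued_linear_def by blast
qed

end

theory Submission
  imports Defs "HOL-Probability.Distributions"
begin

text \<open>
  The necessity of the conditions is a computation with the reproducing kernel
  \<open>K\<^sub>w(z) = exp (z * cnj w)\<close>.  If \<open>m > 0\<close>, the pair \<open>(0, 1)\<close> lies in the graph
  \<open>G\<close>, so by unitarity \<open>(1, 0)\<close> lies in the adjoint, and testing the second pair
  against the first gives \<open>\<langle>1, 1\<rangle> = 0\<close>, which is absurd.  For \<open>m = 0\<close>, the defining equation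
  \<open>psi(w) * f(vphi(w)) = phi(w) * g(w)\<close> reads
  \<open>psi(w) * \<langle>f, K\<^bsub>vphi(w)\<^esub>\<rangle> = phi(w) * \<langle>g, K\<^sub>w\<rangle>\<close>; this says that
  \<open>(cnj (phi w) K\<^sub>w, cnj (psi w) K\<^bsub>vphi(w)\<^esub>)\<close> lies in the adjoint for each \<open>w\<close>.  Unitarity puts
  the reversed pair into \<open>G\<close>, and evaluating at \<open>z\<close> yields
  \<open>psi(z) * cnj (psi w) * K\<^bsub>vphi(w)\<^esub>(vphi z) = phi(z) * cnj (phi w) * K\<^sub>w(z)\<close>.
  On the diagonal this shows that \<open>phi\<close> is zero free.  With \<open>w = 0\<close> it expresses \<open>psi / phi\<close>
  through \<open>vphi\<close>, and what remains is
  \<open>exp (p(z) * cnj (p w)) = exp (z * cnj w)\<close> for \<open>p = vphi - vphi 0\<close>, which forces \<open>p\<close> to be a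
  rotation (\<open>rotation_if_exp_kernel_eq\<close>).

  For sufficiency, the graph is that of a unimodular multiple of a Weyl operator, a weighted
  composition operator whose weight turns the Gaussian density at \<open>z\<close> into the Gaussian density at
  \<open>A * z + B\<close> (\<open>weyl_density\<close>).  Invariance of area under rigid motions makes it isometric, an
  operator of the same kind inverts it (\<open>weyl_inverse\<close>), and so its adjoint is its inverse.

  The reproducing property (\<open>fock_reproducing\<close>) also comes from Weyl operators: at the origin it is
  the mean value property of holomorphic functions integrated against the rotation invariant
  Gaussian (\<open>fock_inner_one\<close>), and a Weyl operator moves the origin to any other point.
\<close>

section \<open>Gaussian measure on the plane\<close>

text \<open>
  The argument is the uniqueness of Haar measure up to a constant: the image measure is again
  translation invariant, and comparing it with \<open>lborel\<close> by Fubini against a fixed function \<open>k\<close>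
  shows that it is a multiple of \<open>lborel\<close>.  Choosing for \<open>k\<close> the indicator of the unit ball, which
  \<open>T\<close> and the reflection at the origin preserve, makes the multiple equal to one.
\<close>

lemma lborel_distr_isometry:
  fixes T T' :: "'a::euclidean_space \<Rightarrow> 'a"
  assumes "linear T" and norm: "\<And>x. norm (T x) = norm x" and inv: "\<And>x. T (T' x) = x"
  shows "distr lborel borel T = lborel"
proof (rule measure_eqI)
  let ?L = "lborel :: 'a measure"
  define k :: "'a \<Rightarrow> ennreal" where "k = indicator (ball 0 1)"
  have [measurable]: "T \<in> borel_measurable borel"
    using \<open>linear T\<close> by (intro borel_measurable_continuous_onI linear_continuous_on linear_conv_bounded_linear[THEN iffD1])
  have [measurable]: "k \<in> borel_measurable borel"
    unfolding k_def by (intro borel_measurable_indicator borel_open open_ball)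
  have k_T: "k (- T x) = k x" for x
    by (simp add: k_def norm indicator_def)
  have k_int: "(\<integral>\<^sup>+x. k x \<partial>?L) = emeasure ?L (ball 0 1)"
    by (simp add: k_def)
  have k_pos: "(\<integral>\<^sup>+x. k x \<partial>?L) \<noteq> 0"
  proof
    assume "(\<integral>\<^sup>+x. k x \<partial>?L) = 0"
    then have "measure ?L (ball 0 1) = 0"
      by (simp add: k_int measure_def)
    then show False
      using content_ball_pos[of 1 "0::'a"] by (simp add: measure_completion)
  qed
  have k_fin: "(\<integral>\<^sup>+x. k x \<partial>?L) \<noteq> \<infinity>"
    using emeasure_lborel_ball_finite[of "0::'a" 1] by (simp add: k_int)
  have shift: "(\<integral>\<^sup>+x. h (a + x) \<partial>?L) = (\<integral>\<^sup>+x. h x \<partial>?L)"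
    if [measurable]: "h \<in> borel_measurable borel" for h :: "'a \<Rightarrow> ennreal" and a
  proof -
    have "(\<integral>\<^sup>+x. h x \<partial>?L) = (\<integral>\<^sup>+x. h x \<partial>distr ?L borel ((+) a))"
      by (simp add: lborel_distr_plus)
    also have "\<dots> = (\<integral>\<^sup>+x. h (a + x) \<partial>?L)"
      by (rule nn_integral_distr) auto
    finally show ?thesis ..
  qed
  show "sets (distr ?L borel T) = sets ?L"
    by simp
  fix E assume "E \<in> sets (distr ?L borel T)"
  then have [measurable]: "E \<in> sets borel"
    by simp
  have "emeasure (distr ?L borel T) E * (\<integral>\<^sup>+y. k y \<partial>?L) =
      (\<integral>\<^sup>+x. indicator E (T x) \<partial>?L) * (\<integral>\<^sup>+y. k y \<partial>?L)"
    by (subst nn_integral_distr[of T ?L borel "indicator E", symmetric]) simp_all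
  also have "\<dots> = (\<integral>\<^sup>+x. (\<integral>\<^sup>+y. indicator E (T x) * k y \<partial>?L) \<partial>?L)"
    by (simp add: nn_integral_cmult nn_integral_multc)
  also have "\<dots> = (\<integral>\<^sup>+x. (\<integral>\<^sup>+y. indicator E (T x) * k (- T x + y) \<partial>?L) \<partial>?L)"
    by (intro nn_integral_cong shift[where h = "\<lambda>y. indicator E (T _) * k y", symmetric]) measurable
  also have "\<dots> = (\<integral>\<^sup>+y. (\<integral>\<^sup>+x. indicator E (T x) * k (- T x + y) \<partial>?L) \<partial>?L)"
    by (rule lborel_pair.Fubini') measurable
  also have "\<dots> = (\<integral>\<^sup>+y. (\<integral>\<^sup>+x. indicator E (y + T x) * k (- T x) \<partial>?L) \<partial>?L)"
  proof (rule nn_integral_cong)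
    fix y
    \<comment> \<open>The image measure inherits translation invariance: a shift by \<open>y\<close> after \<open>T\<close> is a shift
      by a preimage of \<open>y\<close> before \<open>T\<close>.\<close>
    have "(\<integral>\<^sup>+x. indicator E (T x) * k (- T x + y) \<partial>?L) =
        (\<integral>\<^sup>+x. indicator E (T (T' y + x)) * k (- T (T' y + x) + y) \<partial>?L)"
      by (rule shift[symmetric]) measurable
    then show "(\<integral>\<^sup>+x. indicator E (T x) * k (- T x + y) \<partial>?L) =
        (\<integral>\<^sup>+x. indicator E (y + T x) * k (- T x) \<partial>?L)"
      by (simp add: linear_add[OF \<open>linear T\<close>] inv)
  qed
  also have "\<dots> = (\<integral>\<^sup>+x. (\<integral>\<^sup>+y. indicator E (y + T x) * k (- T x) \<partial>?L) \<partial>?L)"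
    by (rule lborel_pair.Fubini') measurable
  also have "\<dots> = (\<integral>\<^sup>+x. emeasure ?L E * k x \<partial>?L)"
    using shift[of "\<lambda>y. indicator E y :: ennreal"]
    by (intro nn_integral_cong) (simp add: nn_integral_multc k_T add.commute[of _ "T _"])
  also have "\<dots> = emeasure ?L E * (\<integral>\<^sup>+x. k x \<partial>?L)"
    by (simp add: nn_integral_cmult)
  finally show "emeasure (distr ?L borel T) E = emeasure ?L E"
    using k_pos k_fin by (simp add: ennreal_mult_cancel_left mult.commute[of _ "integral\<^sup>N _ _"])
qed

lemma distr_lborel_rigid_motion:
  fixes A B :: complex
  assumes "norm A = 1"
  shows "distr lborel borel (\<lambda>z. A * z + B) = lborel"
proof -
  have "distr lborel borel ((*) A) = lborel"
    by (rule lborel_distr_isometry[where T' = "(*) (1 / A)"])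
       (use assms in \<open>auto simp: norm_mult linear_times\<close>)
  moreover have "distr (distr lborel borel ((*) A)) borel ((+) B) = distr lborel borel ((+) B \<circ> (*) A)"
    by (rule distr_distr) auto
  ultimately show ?thesis
    by (simp add: lborel_distr_plus comp_def add.commute)
qed

lemma integral_rigid_motion:
  fixes h :: "complex \<Rightarrow> complex"
  assumes "norm A = 1" and h: "h \<in> borel_measurable borel"
  shows "(LINT z|lborel. h (A * z + B)) = (LINT z|lborel. h z)"
proof -
  have "(LINT z|lborel. h z) = (LINT z|distr lborel borel (\<lambda>z. A * z + B). h z)"
    using assms by (simp add: distr_lborel_rigid_motion)
  also have "\<dots> = (LINT z|lborel. h (A * z + B))"
    by (rule integral_distr) (use h in auto)
  finally show ?thesis ..
qed

lemma integrable_rigid_motion: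
  fixes h :: "complex \<Rightarrow> 'a::{banach, second_countable_topology}"
  assumes "norm A = 1" and h: "integrable lborel h"
  shows "integrable lborel (\<lambda>z. h (A * z + B))"
  using h integrable_distr[of "\<lambda>z. A * z + B" lborel borel h] 
  by (simp add: distr_lborel_rigid_motion[OF \<open>norm A = 1\<close>])

lemma gaussian_complex:
  "has_bochner_integral lborel (\<lambda>z::complex. exp (- (norm z)\<^sup>2)) pi"
proof -
  have "has_bochner_integral lborel (\<lambda>x::real. exp (- x\<^sup>2)) (sqrt pi)"
    using has_bochner_integral_even_function[OF gaussian_moment_0] by simp
  then have one_dim: "(\<integral>\<^sup>+x. ennreal (exp (- x\<^sup>2)) \<partial>lborel) = ennreal (sqrt pi)"
    by (simp add: has_bochner_integral_iff nn_integral_eq_integral)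
  have "(\<integral>\<^sup>+z. ennreal (exp (- (norm (z::complex))\<^sup>2)) \<partial>lborel) =
      (\<integral>\<^sup>+z. (\<Prod>b\<in>Basis. ennreal (exp (- ((z::complex) \<bullet> b)\<^sup>2))) \<partial>lborel)"
    by (intro nn_integral_cong)
       (simp add: Basis_complex_def cmod_def ennreal_mult'[symmetric] exp_add[symmetric])
  also have "\<dots> = (\<Prod>b\<in>(Basis::complex set). ennreal (sqrt pi))"
    by (subst nn_integral_lborel_prod) (auto simp: one_dim)
  also have "\<dots> = ennreal pi"
    by (simp add: Basis_complex_def ennreal_mult'[symmetric])
  finally show ?thesis
    by (intro has_bochner_integral_nn_integral) auto
qed


section \<open>Inner products in Fock space\<close>

lemma measurable_fock_density:
  assumes "f \<in> fock_space" "g \<in> fock_space"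
  shows "(\<lambda>z. f z * cnj (g z) * of_real (exp (- (norm z)\<^sup>2))) \<in> borel_measurable borel"
proof -
  have "continuous_on UNIV f" "continuous_on UNIV g"
    using assms by (auto simp: fock_space_def holomorphic_on_imp_continuous_on)
  then show ?thesis
    by (intro borel_measurable_continuous_onI continuous_intros)
qed

lemma integrable_fock_inner:
  assumes "f \<in> fock_space" "g \<in> fock_space"
  shows "integrable lborel (\<lambda>z. f z * cnj (g z) * of_real (exp (- (norm z)\<^sup>2)))"
proof (rule Bochner_Integration.integrable_bound)
  let ?w = "\<lambda>z :: complex. exp (- (norm z)\<^sup>2)"
  show "integrable lborel (\<lambda>z. (norm (f z))\<^sup>2 * ?w z + (norm (g z))\<^sup>2 * ?w z)"
    using assms by (intro Bochner_Integration.integrable_add) (auto simp: fock_space_def)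
  show "(\<lambda>z. f z * cnj (g z) * of_real (?w z)) \<in> borel_measurable lborel"
    using measurable_fock_density[OF assms] by simp
  show "AE z in lborel. norm (f z * cnj (g z) * of_real (?w z)) \<le>
      norm ((norm (f z))\<^sup>2 * ?w z + (norm (g z))\<^sup>2 * ?w z)"
  proof (rule AE_I2)
    fix z
    have "norm (f z) * norm (g z) \<le> (norm (f z))\<^sup>2 + (norm (g z))\<^sup>2"
      using sum_squares_bound[of "norm (f z)" "norm (g z)"]
        mult_nonneg_nonneg[OF norm_ge_zero norm_ge_zero, of "f z" "g z"] by linarith
    then have "norm (f z) * norm (g z) * ?w z \<le> ((norm (f z))\<^sup>2 + (norm (g z))\<^sup>2) * ?w z"
      by (intro mult_right_mono) auto
    then show "norm (f z * cnj (g z) * of_real (?w z)) \<le>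
        norm ((norm (f z))\<^sup>2 * ?w z + (norm (g z))\<^sup>2 * ?w z)"
      by (simp add: norm_mult distrib_right)
  qed
qed

lemma const_in_fock_space: "(\<lambda>z. c) \<in> fock_space"
  using gaussian_complex by (auto simp: fock_space_def has_bochner_integral_iff)

lemma fock_inner_one_one: "fock_inner (\<lambda>z. 1) (\<lambda>z. 1) = 1"
proof -
  have "(LINT z|lborel. complex_of_real (exp (- (norm (z::complex))\<^sup>2))) = of_real pi"
    using gaussian_complex by (subst integral_complex_of_real) (simp add: has_bochner_integral_iff)
  then show ?thesis
    by (simp add: fock_inner_def)
qed

lemma fock_inner_cnj: "cnj (fock_inner f g) = fock_inner g f"
  by (simp add: fock_inner_def mult.commute flip: Bochner_Integration.integral_cnj)

lemma fock_inner_scale_left: "fock_inner (\<lambda>z. c * f z) g = c * fock_inner f g"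
  by (simp add: fock_inner_def mult.assoc mult.left_commute[of _ c])

lemma fock_inner_scale_right: "fock_inner f (\<lambda>z. c * g z) = cnj c * fock_inner f g"
  using arg_cong[OF fock_inner_scale_left[of c g f], of cnj] by (simp add: fock_inner_cnj)

section \<open>Weyl operators\<close>

text \<open>
  For \<open>norm A = 1\<close> this is the unitary operator implementing the rigid motion
  \<open>z \<mapsto> A * z + B\<close> on Fock space.
\<close>

definition weyl :: "complex \<Rightarrow> complex \<Rightarrow> (complex \<Rightarrow> complex) \<Rightarrow> complex \<Rightarrow> complex" where
  "weyl A B f z = exp (- A * cnj B * z - of_real ((norm B)\<^sup>2 / 2)) * f (A * z + B)"

text \<open>
  The weight is chosen so that completing the square in
  \<open>(norm (A * z + B))\<^sup>2 = (norm z)\<^sup>2 + 2 * Re (A * cnj B * z) + (norm B)\<^sup>2\<close>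
  absorbs it into the Gaussian.  After integration this gives both the invariance of Fock space
  and the preservation of inner products.
\<close>

lemma weyl_density:
  assumes "norm A = 1"
  shows "weyl A B f z * cnj (weyl A B g z) * of_real (exp (- (norm z)\<^sup>2)) =
    f (A * z + B) * cnj (g (A * z + B)) * of_real (exp (- (norm (A * z + B))\<^sup>2))"
proof -
  let ?a = "- A * cnj B * z - of_real ((norm B)\<^sup>2 / 2)"
  have A: "A * cnj A = 1"
    using assms by (simp flip: complex_norm_square)
  have sq: "complex_of_real ((norm w)\<^sup>2) = w * cnj w" for w
    by (rule complex_norm_square)
  have "?a + cnj ?a - of_real ((norm z)\<^sup>2) =
      - (A * cnj B * z + cnj A * B * cnj z + B * cnj B + (A * cnj A) * (z * cnj z))"
    by (simp add: sq A algebra_simps add_divide_distrib flip: of_real_power)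
  also have "\<dots> = - of_real ((norm (A * z + B))\<^sup>2)"
    unfolding sq by (simp add: algebra_simps)
  finally have "exp ?a * cnj (exp ?a) * of_real (exp (- (norm z)\<^sup>2)) =
      of_real (exp (- (norm (A * z + B))\<^sup>2))"
    by (simp add: exp_cnj exp_add[symmetric] flip: exp_of_real)
  moreover have "weyl A B f z * cnj (weyl A B g z) * of_real (exp (- (norm z)\<^sup>2)) =
      (exp ?a * cnj (exp ?a) * of_real (exp (- (norm z)\<^sup>2))) * (f (A * z + B) * cnj (g (A * z + B)))"
    by (simp only: weyl_def complex_cnj_mult mult_ac)
  ultimately show ?thesis
    by (simp only: mult_ac)
qed

lemma weyl_in_fock_space:
  assumes "norm A = 1" "f \<in> fock_space"
  shows "weyl A B f \<in> fock_space"
proof -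
  let ?w = "\<lambda>z :: complex. exp (- (norm z)\<^sup>2)"
  have "(norm (weyl A B f z))\<^sup>2 * ?w z = (norm (f (A * z + B)))\<^sup>2 * ?w (A * z + B)" for z
  proof -
    have "complex_of_real ((norm (weyl A B f z))\<^sup>2 * ?w z) =
        of_real ((norm (f (A * z + B)))\<^sup>2 * ?w (A * z + B))"
      using weyl_density[OF \<open>norm A = 1\<close>, of B f z f]
      unfolding of_real_mult complex_norm_square .
    then show ?thesis
      by (simp only: of_real_eq_iff)
  qed
  moreover have "integrable lborel (\<lambda>z. (norm (f (A * z + B)))\<^sup>2 * ?w (A * z + B))"
    using assms
    by (intro integrable_rigid_motion[where h = "\<lambda>z. (norm (f z))\<^sup>2 * ?w z"]) (auto simp: fock_space_def)
  moreover have "weyl A B f holomorphic_on UNIV"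
  proof -
    have "(\<lambda>z. f (A * z + B)) holomorphic_on UNIV"
      using assms holomorphic_on_compose[of "\<lambda>z. A * z + B" UNIV f]
        holomorphic_on_subset[of f UNIV "range (\<lambda>z. A * z + B)"]
      by (simp add: fock_space_def comp_def holomorphic_intros)
    then show ?thesis
      unfolding weyl_def[abs_def] by (intro holomorphic_intros)
  qed
  ultimately show ?thesis
    by (simp add: fock_space_def)
qed

lemma fock_inner_weyl_weyl:
  assumes "norm A = 1" "f \<in> fock_space" "g \<in> fock_space"
  shows "fock_inner (weyl A B f) (weyl A B g) = fock_inner f g"
  unfolding fock_inner_def weyl_density[OF \<open>norm A = 1\<close>]
  by (subst integral_rigid_motion[where h = "\<lambda>z. f z * cnj (g z) * of_real (exp (- (norm z)\<^sup>2))",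
        OF \<open>norm A = 1\<close>]) (simp_all add: measurable_fock_density assms)

lemma weyl_inverse:
  assumes "norm A = 1"
  shows "weyl (1 / A) (- B / A) (weyl A B f) = f"
    and "weyl A B (weyl (1 / A) (- B / A) f) = f"
proof -
  \<comment> \<open>Inverting the parameters \<open>(1 / A, - B / A)\<close> returns \<open>(A, B)\<close>, so a left inverse valid for all
    parameters is also a right inverse.\<close>
  have cancel: "weyl (1 / A) (- B / A) (weyl A B f) = f" if "norm A = 1" for A B
  proof
    fix z
    define C where "C = cnj A"
    have AC: "A * C = 1"
      using that by (simp add: C_def flip: complex_norm_square)
    then have "A \<noteq> 0"
      by auto
    then have inv: "1 / A = C" "- B / A = - B * C"
      using AC by (simp_all add: divide_eq_eq mult.commute mult.left_commute)
    have "norm (- B * C) = norm B"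
      using that by (simp add: norm_mult C_def)
    moreover have "2 * complex_of_real ((norm B)\<^sup>2 / 2) = B * cnj B"
      by (simp add: complex_norm_square flip: of_real_power)
    moreover have "cnj (- B * C) = - cnj B * A"
      by (simp add: C_def)
    moreover have "- C * (- Bc * A) * z - b + (- A * Bc * (C * z + - B * C) - b) = 0"
      if "2 * b = B * Bc" for b Bc
      using AC that by algebra
    ultimately have "- C * cnj (- B * C) * z - of_real ((norm (- B * C))\<^sup>2 / 2) +
        (- A * cnj B * (C * z + - B * C) - of_real ((norm B)\<^sup>2 / 2)) = 0"
      by (simp only:)
    moreover have "A * (C * z + - B * C) + B = z"
      using AC by algebra
    ultimately show "weyl (1 / A) (- B / A) (weyl A B f) z = f z"
      unfolding weyl_def inv by (simp only: mult.assoc[symmetric] exp_add[symmetric]) simp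
  qed
  show "weyl (1 / A) (- B / A) (weyl A B f) = f"
    by (rule cancel) fact
  have "A \<noteq> 0"
    using assms by auto
  then show "weyl A B (weyl (1 / A) (- B / A) f) = f"
    using cancel[of "1 / A" "- B / A"] assms by (simp add: norm_divide)
qed

lemma weyl_adjoint:
  assumes "norm A = 1" "f \<in> fock_space" "g \<in> fock_space"
  shows "fock_inner (weyl A B f) g = fock_inner f (weyl (1 / A) (- B / A) g)"
proof -
  have "weyl (1 / A) (- B / A) g \<in> fock_space"
    using assms by (intro weyl_in_fock_space) (auto simp: norm_divide)
  then show ?thesis
    using fock_inner_weyl_weyl[of A f "weyl (1 / A) (- B / A) g" B] assms
    by (simp only: weyl_inverse)
qed

section \<open>The reproducing kernel\<close>

text \<open>
  Cauchy's formula on the unit circle for \<open>u \<mapsto> f (u * z)\<close>; letting the circle have radius one and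
  scaling the function instead covers all radii, \<open>z = 0\<close> included, at once.
\<close>

lemma holomorphic_mean_value_circle:
  assumes "f holomorphic_on UNIV"
  shows "((\<lambda>t. f (exp (2 * of_real pi * \<i> * of_real t) * z)) has_integral f 0) {0..1}"
proof -
  define g where "g u = f (u * z)" for u
  have "g holomorphic_on UNIV"
    using holomorphic_on_compose[of "\<lambda>u. u * z" UNIV f]
      holomorphic_on_subset[OF assms, of "range (\<lambda>u. u * z)"]
    by (simp add: g_def[abs_def] comp_def holomorphic_intros)
  then have "((\<lambda>u. g u / (u - 0)) has_contour_integral (2 * of_real pi * \<i> * g 0)) (circlepath 0 1)"
    by (intro Cauchy_integral_circlepath_simple) (auto intro: holomorphic_on_subset)
  then have "((\<lambda>t. 2 * of_real pi * \<i> * g (exp (2 * of_real pi * \<i> * of_real t)))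
      has_integral 2 * of_real pi * \<i> * g 0) {0..1}"
    unfolding has_contour_integral
    by (rule has_integral_eq[rotated]) (subst vector_derivative_circlepath, simp add: circlepath)
  then have "((\<lambda>t. (1 / (2 * of_real pi * \<i>)) * (2 * of_real pi * \<i> * g (exp (2 * of_real pi * \<i> * of_real t))))
      has_integral (1 / (2 * of_real pi * \<i>)) * (2 * of_real pi * \<i> * g 0)) {0..1}"
    by (rule has_integral_mult_right)
  then show ?thesis
    by (simp add: g_def)
qed

text \<open>
  The integral of \<open>f\<close> against the Gaussian does not change when \<open>f\<close> is rotated.  Averaging over all
  rotations and exchanging the integrals replaces \<open>f\<close> by its circular means, which are all \<open>f 0\<close>.
\<close>

lemma fock_inner_one:
  assumes f: "f \<in> fock_space"
  shows "fock_inner f (\<lambda>z. 1) = f 0"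
proof -
  have hol: "f holomorphic_on UNIV"
    using f by (simp add: fock_space_def)
  then have cont: "continuous_on UNIV f"
    by (rule holomorphic_on_imp_continuous_on)
  define w where "w z = complex_of_real (exp (- (norm z)\<^sup>2))" for z :: complex
  define e where "e t = exp (2 * of_real pi * \<i> * complex_of_real t)" for t
  define I where "I = (LINT z|lborel. f z * w z)"
  define F where "F t z = indicator {0..1::real} t *\<^sub>R (f (e t * z) * w z)" for t z
  have e: "norm (e t) = 1" for t
    using norm_exp_i_times[of "2 * pi * t"] by (simp add: e_def mult_ac)
  have cont_F: "continuous_on UNIV (\<lambda>x. f (e (fst x) * snd x) * w (snd x))"
  proof -
    have "continuous_on UNIV (\<lambda>x. f (e (fst x) * snd x))"
      by (rule continuous_on_compose2[OF cont]) (auto simp: e_def intro!: continuous_intros)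
    then show ?thesis
      unfolding w_def by (intro continuous_intros)
  qed
  have meas: "(\<lambda>(t, z). F t z) \<in> borel_measurable (lborel \<Otimes>\<^sub>M lborel)"
  proof -
    have "(\<lambda>x. f (e (fst x) * snd x) * w (snd x)) \<in> borel_measurable (borel :: (real \<times> complex) measure)"
      by (rule borel_measurable_continuous_onI[OF cont_F])
    then have [measurable]: "(\<lambda>x. f (e (fst x) * snd x) * w (snd x)) \<in>
        borel_measurable (borel \<Otimes>\<^sub>M (borel :: complex measure))"
      by (simp add: borel_prod)
    have "(\<lambda>x. indicator {0..1} (fst x) *\<^sub>R (f (e (fst x) * snd x) * w (snd x))) \<in>
        borel_measurable (borel \<Otimes>\<^sub>M (borel :: complex measure))"
      by measurable
    then show ?thesis
      by (simp add: F_def case_prod_beta)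
  qed
  have int_f: "integrable lborel (\<lambda>z. f z * w z)"
    using integrable_fock_inner[OF f const_in_fock_space[of 1]] by (simp add: w_def)
  have rot: "f (e t * z) * w z = (\<lambda>z. f z * w z) (e t * z + 0)" for t z
    by (simp add: w_def norm_mult e)
  have int_rot: "integrable lborel (\<lambda>z. f (e t * z) * w z)" for t
    unfolding rot by (rule integrable_rigid_motion[OF e int_f])
  have I_rot: "(LINT z|lborel. f (e t * z) * w z) = I" for t
    unfolding rot I_def
    by (rule integral_rigid_motion[OF e]) (use int_f in auto)
  \<comment> \<open>Rotation invariance of the absolute integral makes the double integral absolutely convergent.\<close>
  have norm_rot: "(LINT z|lborel. norm (f (e t * z) * w z)) = (LINT z|lborel. norm (f z * w z))" for t
  proof -
    have "(LINT z|lborel. complex_of_real (norm (f (e t * z) * w z))) =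
        (LINT z|lborel. complex_of_real (norm (f z * w z)))"
      unfolding rot
      by (rule integral_rigid_motion[OF e, where h = "\<lambda>z. complex_of_real (norm (f z * w z))"])
         (use int_f in auto)
    then show ?thesis
      by simp
  qed
  have ind: "integrable lborel (\<lambda>t. indicator {0..1::real} t *\<^sub>R c)"
    "(LINT t|lborel. indicator {0..1::real} t *\<^sub>R c) = c" for c :: "'b :: {banach, second_countable_topology}"
    by simp_all
  have inner: "(LINT t|lborel. F t z) = f 0 * w z" for z
  proof -
    have "continuous_on {0..1} (\<lambda>t. f (e t * z))"
      by (rule continuous_on_compose2[OF cont]) (auto simp: e_def intro!: continuous_intros)
    then have "set_integrable lborel {0..1} (\<lambda>t. f (e t * z))"
      unfolding set_integrable_def by (intro borel_integrable_compact) auto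
    then have "(LINT t:{0..1}|lborel. f (e t * z)) = integral {0..1} (\<lambda>t. f (e t * z))"
      by (rule set_borel_integral_eq_integral)
    also have "\<dots> = f 0"
      using holomorphic_mean_value_circle[OF hol, of z] by (simp add: e_def integral_unique)
    finally show ?thesis
      by (simp add: F_def set_lebesgue_integral_def scaleR_conv_of_real mult.assoc[symmetric])
  qed
  have "integrable (lborel \<Otimes>\<^sub>M lborel) (\<lambda>(t, z). F t z)"
  proof (rule lborel_pair.Fubini_integrable[OF meas])
    show "integrable lborel (\<lambda>t. LINT z|lborel. norm (case (t, z) of (t, z) \<Rightarrow> F t z))"
      using ind(1)[of "LINT z|lborel. norm (f z * w z)"] by (simp add: F_def norm_rot)
    show "AE t in lborel. integrable lborel (\<lambda>z. case (t, z) of (t, z) \<Rightarrow> F t z)"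
      by (simp add: F_def int_rot)
  qed
  then have "(LINT z|lborel. (LINT t|lborel. F t z)) = (LINT t|lborel. (LINT z|lborel. F t z))"
    by (rule lborel_pair.Fubini_integral)
  also have "\<dots> = I"
    by (simp add: F_def I_rot ind)
  finally have "f 0 * (LINT z|lborel. w z) = I"
    by (simp add: inner)
  moreover have "(LINT z|lborel. w z) = of_real pi"
    using fock_inner_one_one by (simp add: fock_inner_def w_def field_simps)
  ultimately show ?thesis
    by (simp add: fock_inner_def I_def w_def field_simps)
qed

definition fock_kernel :: "complex \<Rightarrow> complex \<Rightarrow> complex" where
  "fock_kernel w z = exp (z * cnj w)"

text \<open>
  The kernel at \<open>w\<close> is a translate of the constant one, the kernel at the origin.  This moves the
  evaluation at the origin in \<open>fock_inner_one\<close> to \<open>w\<close>.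
\<close>

lemma fock_kernel_eq_weyl:
  "fock_kernel w = (\<lambda>z. of_real (exp ((norm w)\<^sup>2 / 2)) * weyl 1 (- w) (\<lambda>z. 1) z)"
  by (rule ext) (simp add: fock_kernel_def weyl_def mult.commute exp_add[symmetric] flip: exp_of_real)

lemma fock_kernel_in_fock_space: "fock_kernel w \<in> fock_space"
  unfolding fock_kernel_eq_weyl
  by (intro scale_in_fock_space weyl_in_fock_space const_in_fock_space) simp

lemma fock_reproducing:
  assumes "f \<in> fock_space"
  shows "fock_inner f (fock_kernel w) = f w"
proof -
  have "fock_inner f (weyl 1 (- w) (\<lambda>z. 1)) = fock_inner (weyl 1 w f) (\<lambda>z. 1)"
    using weyl_adjoint[of 1 f "\<lambda>z. 1" w] assms by (simp add: const_in_fock_space)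
  also have "\<dots> = weyl 1 w f 0"
    using assms by (intro fock_inner_one weyl_in_fock_space) auto
  also have "\<dots> = of_real (exp (- ((norm w)\<^sup>2 / 2))) * f w"
    by (simp add: weyl_def flip: exp_of_real)
  finally show ?thesis
    unfolding fock_kernel_eq_weyl fock_inner_scale_right
    by (simp add: mult.assoc[symmetric] exp_add[symmetric] flip: of_real_mult)
qed

lemma fock_space_eqI:
  assumes "u \<in> fock_space" "v \<in> fock_space"
    and eq: "\<And>f. f \<in> fock_space \<Longrightarrow> fock_inner f u = fock_inner f v"
  shows "u = v"
proof
  fix w
  have "cnj (fock_inner u (fock_kernel w)) = cnj (fock_inner v (fock_kernel w))"
    using eq[OF fock_kernel_in_fock_space] by (simp add: fock_inner_cnj)
  then show "u w = v w"
    using assms by (simp add: fock_reproducing)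
qed

section \<open>Unitarity\<close>

text \<open>
  Moving the operator to the other side of the inner product shows that \<open>(u, v)\<close> is in the adjoint
  iff the inverse operator at \<open>u\<close> and the function \<open>v\<close> have the same inner products with all of Fock
  space, hence iff they agree.
\<close>

lemma fock_unitary_scaled_weyl:
  assumes A: "norm A = 1" and D: "norm D = 1"
  shows "fock_unitary {(f, g). f \<in> fock_space \<and> g = (\<lambda>z. D * weyl A B f z)}"
proof -
  have DD: "D * cnj D = 1"
    using D by (simp flip: complex_norm_square)
  let ?V = "\<lambda>u z. cnj D * weyl (1 / A) (- B / A) u z"
  have V: "?V u \<in> fock_space" if "u \<in> fock_space" for u
    using that A by (intro scale_in_fock_space weyl_in_fock_space) (auto simp: norm_divide)
  have W: "(\<lambda>z. D * weyl A B f z) \<in> fock_space" if "f \<in> fock_space" for f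
    using that A by (intro scale_in_fock_space weyl_in_fock_space)
  have adj: "fock_inner (\<lambda>z. D * weyl A B f z) u = fock_inner f (?V u)"
    if "f \<in> fock_space" "u \<in> fock_space" for f u
    using weyl_adjoint[OF A that] by (simp add: fock_inner_scale_left fock_inner_scale_right)
  have scale: "weyl a b (\<lambda>z. c * f z) = (\<lambda>z. c * weyl a b f z)" for a b c f
    by (rule ext) (simp add: weyl_def)
  have inv: "?V (\<lambda>z. D * weyl A B f z) = f" "(\<lambda>z. D * weyl A B (?V f) z) = f" for f
    using DD by (simp_all only: scale weyl_inverse[OF A]) (simp_all add: mult.assoc[symmetric] mult.commute)
  have "(u, v) \<in> fock_adjoint {(f, g). f \<in> fock_space \<and> g = (\<lambda>z. D * weyl A B f z)} \<longleftrightarrow>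
      v \<in> fock_space \<and> u = (\<lambda>z. D * weyl A B v z)" for u v
  proof -
    have "(u, v) \<in> fock_adjoint {(f, g). f \<in> fock_space \<and> g = (\<lambda>z. D * weyl A B f z)} \<longleftrightarrow>
        u \<in> fock_space \<and> v \<in> fock_space \<and> (\<forall>f\<in>fock_space. fock_inner f (?V u) = fock_inner f v)"
      by (auto simp: fock_adjoint_def adj)
    also have "\<dots> \<longleftrightarrow> u \<in> fock_space \<and> v \<in> fock_space \<and> ?V u = v"
      using V fock_space_eqI by blast
    also have "\<dots> \<longleftrightarrow> v \<in> fock_space \<and> u = (\<lambda>z. D * weyl A B v z)"
    proof (intro iffI conjI; elim conjE)
      assume "?V u = v"
      then show "u = (\<lambda>z. D * weyl A B v z)"
        using inv(2)[of u] by (simp only:)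
    next
      assume u: "u = (\<lambda>z. D * weyl A B v z)" and "v \<in> fock_space"
      then show "u \<in> fock_space"
        using W by (simp only:)
      show "?V u = v"
        unfolding u by (rule inv)
    qed
    finally show ?thesis .
  qed
  then show ?thesis
    unfolding fock_unitary_def by auto
qed

lemma norm_eq_1_if_mult_cnj:
  assumes "z * cnj z = 1"
  shows "norm z = 1"
proof -
  have "complex_of_real ((norm z)\<^sup>2) = 1"
    using assms by (simp only: complex_norm_square)
  then have "(norm z)\<^sup>2 = 1"
    by (simp only: of_real_eq_1_iff)
  then show ?thesis
    using norm_ge_zero[of z] by (auto simp: power2_eq_1_iff)
qed

text \<open>
  The difference of the two exponents takes values in \<open>2 * pi * \<i> * \<int>\<close>, so for fixed \<open>w\<close> it is a
  continuous function of \<open>z\<close> with discrete range, hence constant, and it vanishes at \<open>z = 0\<close>.  The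
  exponents therefore agree, and \<open>w = 1\<close> shows that \<open>p\<close> is linear with slope \<open>p 1\<close>.
\<close>

lemma rotation_if_exp_kernel_eq:
  fixes p :: "complex \<Rightarrow> complex"
  assumes cont: "continuous_on UNIV p" and p0: "p 0 = 0"
    and eq: "\<And>z w. exp (p z * cnj (p w)) = exp (z * cnj w)"
  shows "\<exists>A. norm A = 1 \<and> (\<forall>z. p z = A * z)"
proof -
  have lin: "p z * cnj (p w) = z * cnj w" for z w
  proof -
    define q where "q z = p z * cnj (p w) - z * cnj w" for z
    have "continuous_on UNIV q"
      unfolding q_def by (intro continuous_intros cont)
    moreover have "\<exists>e>0. \<forall>y. y \<in> UNIV \<and> q y \<noteq> q x \<longrightarrow> e \<le> norm (q y - q x)" for x
    proof (intro exI[of _ "2 * pi"] conjI allI impI)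
      fix y assume "y \<in> UNIV \<and> q y \<noteq> q x"
      obtain k l :: int where "q x = of_real (of_int (2 * k) * pi) * \<i>" "q y = of_real (of_int (2 * l) * pi) * \<i>"
        using eq[of x w] eq[of y w] unfolding exp_eq q_def by (auto simp: algebra_simps)
      then have *: "q y - q x = of_real (of_int (2 * (l - k)) * pi) * \<i>"
        by (simp add: algebra_simps)
      with \<open>y \<in> UNIV \<and> q y \<noteq> q x\<close> have "l \<noteq> k"
        by auto
      then have "0 < \<bar>l - k\<bar>"
        by simp
      then have "1 \<le> real_of_int \<bar>l - k\<bar>"
        by linarith
      then have "2 * pi * 1 \<le> 2 * pi * real_of_int \<bar>l - k\<bar>"
        by (intro mult_left_mono) auto
      also have "\<dots> = norm (q y - q x)"
        unfolding * norm_mult norm_of_real by (simp only: abs_mult of_int_mult of_int_abs) simp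
      finally show "2 * pi \<le> norm (q y - q x)"
        by simp
    qed simp
    ultimately have "q constant_on UNIV"
      by (intro continuous_discrete_range_constant) auto
    then have "q z = q 0"
      by (auto simp: constant_on_def)
    then show ?thesis
      by (simp add: q_def p0)
  qed
  define A where "A = p 1"
  have "A * cnj A = 1"
    using lin[of 1 1] by (simp add: A_def)
  then have "norm A = 1"
    by (rule norm_eq_1_if_mult_cnj)
  moreover have "p z = A * z" for z
  proof -
    have "p z = (p z * cnj A) * A"
      using \<open>A * cnj A = 1\<close> by algebra
    then show ?thesis
      using lin[of z 1] by (simp add: A_def mult.commute)
  qed
  ultimately show ?thesis
    by blast
qed

theorem theorem7p1:
  fixes m :: nat and psi vphi phi :: "complex \<Rightarrow> complex"
  assumes "psi holomorphic_on UNIV" and "vphi holomorphic_on UNIV" and "phi holomorphic_on UNIV"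
    and "\<exists>z. phi z \<noteq> 0"
    and "\<forall>z. psi z \<noteq> 0"
  shows "fock_unitary (S_max m psi vphi phi) \<longleftrightarrow>
    m = 0 \<and> (\<exists>A B D :: complex. norm A = 1 \<and> norm D = 1 \<and>
      (\<forall>z. vphi z = A * z + B) \<and>
      (\<forall>z. psi z = phi z * (D * exp (- A * cnj B * z - of_real ((norm B)\<^sup>2 / 2)))))"
proof
  assume unitary: "fock_unitary (S_max m psi vphi phi)"
  have m: "m = 0"
  proof (rule ccontr)
    assume "m \<noteq> 0"
    then have "(deriv ^^ m) (\<lambda>z. 1) z = 0" for z :: complex
      by (simp add: higher_deriv_const)
    then have "((\<lambda>z. 0), (\<lambda>z. 1)) \<in> S_max m psi vphi phi"
      by (simp add: S_max_def const_in_fock_space)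
    moreover from this have "((\<lambda>z. 1), (\<lambda>z. 0)) \<in> fock_adjoint (S_max m psi vphi phi)"
      using unitary by (simp add: fock_unitary_def)
    ultimately have "fock_inner (\<lambda>z. 1) (\<lambda>z. 1) = fock_inner (\<lambda>z. 0) (\<lambda>z. 0)"
      by (auto simp: fock_adjoint_def)
    then show False
      by (simp add: fock_inner_one_one) (simp add: fock_inner_def)
  qed
  \<comment> \<open>By the reproducing property, membership of these pairs in the adjoint is the defining equation
    of the graph at \<open>w\<close>.\<close>
  have "((\<lambda>z. cnj (phi w) * fock_kernel w z), (\<lambda>z. cnj (psi w) * fock_kernel (vphi w) z))
      \<in> fock_adjoint (S_max m psi vphi phi)" for w
    by (auto simp: fock_adjoint_def S_max_def m fock_inner_scale_right fock_reproducing
        intro!: scale_in_fock_space fock_kernel_in_fock_space)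
  then have "((\<lambda>z. cnj (psi w) * fock_kernel (vphi w) z), (\<lambda>z. cnj (phi w) * fock_kernel w z))
      \<in> S_max m psi vphi phi" for w
    using unitary by (simp add: fock_unitary_def)
  then have kernel_eq: "psi z * cnj (psi w) * exp (vphi z * cnj (vphi w)) =
      phi z * cnj (phi w) * exp (z * cnj w)" for z w
    by (simp add: S_max_def m fock_kernel_def mult.assoc)
  have psi_nz: "psi z \<noteq> 0" for z
    using assms by blast
  have phi_nz: "phi z \<noteq> 0" for z
    using kernel_eq[of z z] psi_nz[of z] by auto
  define h where "h z = psi z / phi z" for z
  have h_nz: "h z \<noteq> 0" for z
    by (simp add: h_def psi_nz phi_nz)
  have h_eq: "h z * cnj (h w) * exp (vphi z * cnj (vphi w)) = exp (z * cnj w)" for z w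
    using kernel_eq[of z w] phi_nz[of z] phi_nz[of w] by (simp add: h_def field_simps)
  define B where "B = vphi 0"
  define p where "p z = vphi z - B" for z
  define d where "d = cnj (h 0)"
  have d_nz: "d \<noteq> 0"
    by (simp add: d_def h_nz)
  have h_formula: "h z = exp (- vphi z * cnj B) / d" for z
    using h_eq[of z 0] d_nz by (simp add: B_def d_def exp_minus field_simps)
  have d_norm: "d * cnj d = exp (- B * cnj B)"
    using h_eq[of 0 0] by (simp add: B_def d_def exp_minus field_simps)
  have "exp (p z * cnj (p w)) = exp (z * cnj w)" for z w
  proof -
    have "exp (z * cnj w) = exp (- vphi z * cnj B) * exp (- cnj (vphi w) * B) *
        exp (vphi z * cnj (vphi w)) / (d * cnj d)"
      using h_eq[of z w] unfolding h_formula by (simp add: exp_cnj)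
    also have "\<dots> = exp (p z * cnj (p w))"
      unfolding d_norm p_def by (simp add: exp_add[symmetric] exp_diff[symmetric] algebra_simps)
    finally show ?thesis ..
  qed
  moreover have "continuous_on UNIV p"
    unfolding p_def
    using assms by (intro continuous_intros holomorphic_on_imp_continuous_on)
  ultimately obtain A where A: "norm A = 1" and p: "\<And>z. p z = A * z"
    using rotation_if_exp_kernel_eq[of p] by (auto simp: p_def B_def)
  \<comment> \<open>The formula for \<open>h\<close> has the constant \<open>exp (- (norm B)\<^sup>2) / d\<close>; half of the exponent goes into
    the weight of the Weyl operator, and the other half makes the remaining factor unimodular.\<close>
  define D where "D = exp (- of_real ((norm B)\<^sup>2 / 2)) / d"
  have B_sq: "B * cnj B = of_real ((norm B)\<^sup>2 / 2) + of_real ((norm B)\<^sup>2 / 2)"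
    unfolding complex_norm_square[symmetric] of_real_add[symmetric] by (simp only: field_sum_of_halves)
  have "D * cnj D = exp (- B * cnj B) / (d * cnj d)"
    unfolding D_def complex_cnj_divide exp_cnj complex_cnj_minus complex_cnj_complex_of_real
      times_divide_times_eq exp_add[symmetric] mult_minus_left B_sq by simp
  then have "D * cnj D = 1"
    by (simp only: d_norm) simp
  then have D_norm: "norm D = 1"
    by (rule norm_eq_1_if_mult_cnj)
  have vphi: "vphi z = A * z + B" for z
    using p[of z] by (simp add: p_def algebra_simps)
  have psi: "psi z = phi z * (D * exp (- A * cnj B * z - of_real ((norm B)\<^sup>2 / 2)))" for z
  proof -
    have "- vphi z * cnj B = - of_real ((norm B)\<^sup>2 / 2) + (- A * cnj B * z - of_real ((norm B)\<^sup>2 / 2))"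
      using B_sq unfolding vphi by (simp add: algebra_simps)
    then have "h z = D * exp (- A * cnj B * z - of_real ((norm B)\<^sup>2 / 2))"
      unfolding h_formula D_def by (simp only: exp_add times_divide_eq_left)
    then show ?thesis
      using phi_nz[of z] by (simp add: h_def field_simps)
  qed
  show "m = 0 \<and> (\<exists>A B D :: complex. norm A = 1 \<and> norm D = 1 \<and>
      (\<forall>z. vphi z = A * z + B) \<and>
      (\<forall>z. psi z = phi z * (D * exp (- A * cnj B * z - of_real ((norm B)\<^sup>2 / 2)))))"
    by (rule conjI[OF m], rule exI[of _ A], rule exI[of _ B], rule exI[of _ D])
       (intro conjI allI A D_norm vphi psi)
next
  assume "m = 0 \<and> (\<exists>A B D :: complex. norm A = 1 \<and> norm D = 1 \<and>
      (\<forall>z. vphi z = A * z + B) \<and>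
      (\<forall>z. psi z = phi z * (D * exp (- A * cnj B * z - of_real ((norm B)\<^sup>2 / 2)))))"
  then obtain A B D where m: "m = 0" and A: "norm A = 1" and D: "norm D = 1"
    and vphi: "\<And>z. vphi z = A * z + B"
    and psi: "\<And>z. psi z = phi z * (D * exp (- A * cnj B * z - of_real ((norm B)\<^sup>2 / 2)))"
    by blast
  (* The graph equation can be divided by phi because psi = phi * ... is zero free. *)
  have phi_nz: "phi z \<noteq> 0" for z
    using assms(5) psi[of z] by auto
  have "psi z * f (vphi z) = phi z * g z \<longleftrightarrow> g z = D * weyl A B f z" for f g z
    using phi_nz[of z] unfolding psi vphi weyl_def by (auto simp: mult.assoc)
  then have "(f, g) \<in> S_max m psi vphi phi \<longleftrightarrow>
      f \<in> fock_space \<and> g \<in> fock_space \<and> g = (\<lambda>z. D * weyl A B f z)" for f g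
    by (simp add: S_max_def m fun_eq_iff)
  moreover have "(\<lambda>z. D * weyl A B f z) \<in> fock_space" if "f \<in> fock_space" for f
    using that A by (intro scale_in_fock_space weyl_in_fock_space)
  ultimately have "S_max m psi vphi phi =
      {(f, g). f \<in> fock_space \<and> g = (\<lambda>z. D * weyl A B f z)}"
    by blast
  then show "fock_unitary (S_max m psi vphi phi)"
    using fock_unitary_scaled_weyl[OF A D] by simp
qed

end
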